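(* Let $2\leq d_1\leq d_2$ and let $\rho$ be a quantum state on $\mathbb{C}^{d_1}\otimes\mathbb{C}^{d_2}$ such that $(T_{d_1}\otimes\mathrm{id}_{d_2})(\rho)=\rho$. Then $\mathrm{SN}(\rho)\leq d_1-1$.
   Context: $T_{d}$ is the transposition on $\mathcal{M}_d$ in the computational basis, $T_d(\ket{i}\bra{j})=\ket{j}\bra{i}$. A quantum state is a unit-trace positive semidefinite matrix. The Schmidt rank of $\ket{\psi}$ is the rank of $\mathrm{tr}_A\ket{\psi}\bra{\psi}$; $\mathrm{SN}(\rho)$ is the minimum over decompositions $\rho=\sum_ip_i\ket{\psi_i}\bra{\psi_i}$ into convex combinations of pure states of the maximal Schmidt rank of the $\ket{\psi_i}$. *)

theory Defs
  imports "Jordan_Normal_Form.Matrix" "Jordan_Normal_Form.DL_Rank"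
begin

text \<open>Bipartite system C^d1 (x) C^d2, computational product basis |i>|j> with
  i < d1, j < d2 is identified with the standard basis vector number i * d2 + j of
  C^(d1*d2). Operators are complex (d1*d2) x (d1*d2) matrices.\<close>

definition bidx :: "nat \<Rightarrow> nat \<Rightarrow> nat \<Rightarrow> nat" where
  "bidx d2 i j = i * d2 + j"

definition mtrace :: "complex mat \<Rightarrow> complex" where
  "mtrace A = (\<Sum>i<dim_row A. A $$ (i, i))"

definition psd :: "complex mat \<Rightarrow> bool" where
  "psd A \<longleftrightarrow> (\<exists>n. A \<in> carrier_mat n n \<and>
     (\<forall>v \<in> carrier_vec n.
        let q = (\<Sum>i<n. cnj (v $ i) * (A *\<^sub>v v) $ i) in Im q = 0 \<and> Re q \<ge> 0))"

definition quantum_state :: "nat \<Rightarrow> complex mat \<Rightarrow> bool" where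
  "quantum_state n \<rho> \<longleftrightarrow> \<rho> \<in> carrier_mat n n \<and> psd \<rho> \<and> mtrace \<rho> = 1"

text \<open>Partial transpose on the first factor: (T_d1 (x) id_d2)(|i><k| (x) |j><l|)
  = |k><i| (x) |j><l|.\<close>
definition partial_transpose_A :: "nat \<Rightarrow> nat \<Rightarrow> complex mat \<Rightarrow> complex mat" where
  "partial_transpose_A d1 d2 \<rho> = mat (d1 * d2) (d1 * d2)
     (\<lambda>(r, c). \<rho> $$ (bidx d2 (c div d2) (r mod d2), bidx d2 (r div d2) (c mod d2)))"

definition partial_trace_A :: "nat \<Rightarrow> nat \<Rightarrow> complex mat \<Rightarrow> complex mat" where
  "partial_trace_A d1 d2 M = mat d2 d2
     (\<lambda>(j, l). \<Sum>i<d1. M $$ (bidx d2 i j, bidx d2 i l))"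

definition outer :: "complex vec \<Rightarrow> complex mat" where
  "outer \<psi> = mat (dim_vec \<psi>) (dim_vec \<psi>) (\<lambda>(r, c). \<psi> $ r * cnj (\<psi> $ c))"

definition unit_vec_c :: "nat \<Rightarrow> complex vec \<Rightarrow> bool" where
  "unit_vec_c n \<psi> \<longleftrightarrow> \<psi> \<in> carrier_vec n \<and> (\<Sum>i<n. (cmod (\<psi> $ i))\<^sup>2) = 1"

definition schmidt_rank :: "nat \<Rightarrow> nat \<Rightarrow> complex vec \<Rightarrow> nat" where
  "schmidt_rank d1 d2 \<psi> =
     vec_space.rank d2 (partial_trace_A d1 d2 (outer \<psi>))"

definition pure_decomposition ::
  "nat \<Rightarrow> nat \<Rightarrow> complex mat \<Rightarrow> nat \<Rightarrow> (nat \<Rightarrow> real) \<Rightarrow> (nat \<Rightarrow> complex vec) \<Rightarrow> bool" where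
  "pure_decomposition d1 d2 \<rho> m p \<psi> \<longleftrightarrow>
     (\<forall>k<m. p k \<ge> 0 \<and> unit_vec_c (d1 * d2) (\<psi> k)) \<and> (\<Sum>k<m. p k) = 1 \<and>
     \<rho> = mat (d1 * d2) (d1 * d2)
            (\<lambda>(r, c). \<Sum>k<m. complex_of_real (p k) * (outer (\<psi> k) $$ (r, c)))"

definition schmidt_number :: "nat \<Rightarrow> nat \<Rightarrow> complex mat \<Rightarrow> nat" where
  "schmidt_number d1 d2 \<rho> =
     Inf {Max (schmidt_rank d1 d2 ` \<psi> ` {..<m}) | m p \<psi>. pure_decomposition d1 d2 \<rho> m p \<psi>}"

end

theory Submission
  imports Defs "Jordan_Normal_Form.Spectral_Radius"
begin

text \<open>
  Write \<open>\<rho> = \<Sum>\<^sub>k \<phi>\<^sub>k \<phi>\<^sub>k\<^sup>*\<close> and let \<open>X\<close>, \<open>Y\<close> be the matrices whose columns are the blocks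
  \<open>\<langle>0|\<phi>\<^sub>k\<close> and \<open>\<langle>1|\<phi>\<^sub>k\<close>. Invariance under the partial transpose gives \<open>X Y\<^sup>* = Y X\<^sup>*\<close>. If \<open>X\<close> is
  injective this forces \<open>Y = X Z\<close> with \<open>Z = Y\<^sup>* X (X\<^sup>* X)\<^sup>-\<^sup>1\<close>, whose eigenvalues are real; hence there
  is always a unit vector \<open>u\<close> with \<open>X u = 0\<close> or \<open>Y u = t X u\<close>, \<open>t\<close> real. Completing \<open>u\<close> to a unitary
  matrix and replacing the family \<open>\<phi>\<close> by the corresponding combinations splits off one vector
  whose first two blocks are dependent over the reals. Such a vector contributes nothing to
  \<open>X Y\<^sup>* - Y X\<^sup>*\<close>, so one can iterate. In the end every vector of the decomposition has
  linearly dependent blocks 0 and 1, hence Schmidt rank at most \<open>d\<^sub>1 - 1\<close>.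
\<close>

section \<open>Positive semidefinite kernels as Gram sums\<close>

definition qform :: "(nat \<Rightarrow> nat \<Rightarrow> complex) \<Rightarrow> nat \<Rightarrow> (nat \<Rightarrow> complex) \<Rightarrow> complex" where
  "qform A n v = (\<Sum>i<n. \<Sum>j<n. cnj (v i) * A i j * v j)"

lemma qform_Suc:
  "qform A (Suc n) v = qform A n v + cnj (v n) * (\<Sum>j<n. A n j * v j)
     + (\<Sum>i<n. cnj (v i) * A i n) * v n + cnj (v n) * A n n * v n"
  by (simp add: qform_def sum.distrib sum_distrib_left sum_distrib_right mult.assoc)

text \<open>Evaluation at \<open>e_i + c e_j\<close>; varying \<open>c\<close> isolates the
  off-diagonal entries.\<close>

lemma qform_two_points:
  assumes "i < n" "j < n" "i \<noteq> j"
  shows "qform A n (\<lambda>k. if k = i then 1 else if k = j then c else 0)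
    = A i i + c * A i j + cnj c * A j i + cnj c * c * A j j"
proof -
  let ?v = "\<lambda>k. if k = i then 1 else if k = j then c else 0"
  have row: "(\<Sum>l<n. cnj (?v k) * A k l * ?v l) = cnj (?v k) * (A k i + A k j * c)" for k
  proof -
    have "(\<Sum>l<n. cnj (?v k) * A k l * ?v l) = (\<Sum>l\<in>{i,j}. cnj (?v k) * A k l * ?v l)"
      using assms by (intro sum.mono_neutral_right) auto
    also have "\<dots> = cnj (?v k) * (A k i + A k j * c)"
      using assms by (auto simp: algebra_simps)
    finally show ?thesis .
  qed
  have "qform A n ?v = (\<Sum>k<n. cnj (?v k) * (A k i + A k j * c))"
    unfolding qform_def by (simp only: row)
  also have "\<dots> = (\<Sum>k\<in>{i,j}. cnj (?v k) * (A k i + A k j * c))"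
    using assms by (intro sum.mono_neutral_right) auto
  also have "\<dots> = A i i + c * A i j + cnj c * A j i + cnj c * c * A j j"
    using assms by (auto simp: algebra_simps)
  finally show ?thesis .
qed

lemma qform_one_point:
  assumes "i < n"
  shows "qform A n (\<lambda>k. if k = i then 1 else 0) = A i i"
proof -
  let ?v = "\<lambda>k. if k = i then 1 else 0"
  have "(\<Sum>l<n. cnj (?v k) * A k l * ?v l) = (\<Sum>l\<in>{i}. cnj (?v k) * A k l * ?v l)" for k
    using assms by (intro sum.mono_neutral_right) auto
  then have "qform A n ?v = (\<Sum>k<n. cnj (?v k) * A k i)"
    unfolding qform_def by simp
  also have "\<dots> = (\<Sum>k\<in>{i}. cnj (?v k) * A k i)"
    using assms by (intro sum.mono_neutral_right) auto
  finally show ?thesis by simp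
qed

text \<open>Polarization: once the diagonal is real, \<open>c = 1\<close> makes the imaginary parts
  of \<open>A i j\<close> and \<open>A j i\<close> opposite, and \<open>c = \<i>\<close> makes their
  real parts equal.\<close>

lemma real_qform_hermitian:
  assumes real: "\<And>v. Im (qform A n v) = 0" and "i < n" "j < n"
  shows "A i j = cnj (A j i)"
proof (cases "i = j")
  case True
  then show ?thesis
    using real[of "\<lambda>k. if k = i then 1 else 0"] qform_one_point[OF \<open>i < n\<close>, of A]
    by (simp add: complex_eq_iff)
next
  case False
  note two = real[of "\<lambda>k. if k = i then 1 else if k = j then _ else 0",
      unfolded qform_two_points[OF \<open>i < n\<close> \<open>j < n\<close> False]]
  have "Im (A i i) = 0" "Im (A j j) = 0"
    using real[of "\<lambda>k. if k = i then 1 else 0"] real[of "\<lambda>k. if k = j then 1 else 0"]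
      qform_one_point[of _ n A] assms by simp_all
  then show ?thesis
    using two[of 1] two[of \<i>] by (simp add: complex_eq_iff)
qed

text \<open>With \<open>A j j = 0\<close> the form at \<open>e_i + c e_j\<close> is real-affine in
  \<open>c\<close>, so a nonzero \<open>A i j\<close> would make it unbounded below. This handles a
  vanishing pivot in the factorization that follows.\<close>

lemma psd_kernel_zero_diag:
  assumes herm: "\<And>i j. i < n \<Longrightarrow> j < n \<Longrightarrow> A i j = cnj (A j i)"
    and pos: "\<And>v. Re (qform A n v) \<ge> 0"
    and ij: "i < n" "j < n" and "A j j = 0"
  shows "A i j = 0"
proof (rule ccontr)
  assume nz: "A i j \<noteq> 0"
  then have "i \<noteq> j" using \<open>A j j = 0\<close> by auto
  \<comment> \<open>large enough that the form is negative at the test vector \<open>e\<^sub>i + c e\<^sub>j\<close>\<close>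
  define m where "m = (\<bar>Re (A i i)\<bar> + 1) / (2 * (cmod (A i j))\<^sup>2)"
  define c where "c = - of_real m * cnj (A i j)"
  have Aji: "A j i = cnj (A i j)" by (rule herm[OF ij(2,1)])
  have "A i i + c * A i j + cnj c * A j i + cnj c * c * A j j
      = A i i - of_real (2 * m) * (A i j * cnj (A i j))"
    unfolding Aji c_def \<open>A j j = 0\<close> by (simp add: algebra_simps)
  also have "A i j * cnj (A i j) = of_real ((cmod (A i j))\<^sup>2)"
    by (rule complex_norm_square[symmetric])
  finally have "Re (A i i) - 2 * m * (cmod (A i j))\<^sup>2 \<ge> 0"
    using pos[of "\<lambda>k. if k = i then 1 else if k = j then c else 0"]
    unfolding qform_two_points[OF ij \<open>i \<noteq> j\<close>]
    by (simp only: of_real_mult[symmetric] minus_complex.sel Re_complex_of_real)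
  moreover have "2 * m * (cmod (A i j))\<^sup>2 = \<bar>Re (A i i)\<bar> + 1"
    using nz by (simp add: m_def)
  ultimately show False by linarith
qed

text \<open>Cholesky factorization by induction: the last coordinate is eliminated, and the Schur
  complement \<open>B\<close> of the pivot is again Hermitian and positive semidefinite.\<close>

lemma psd_kernel_decomposition:
  assumes herm: "\<And>i j. i < n \<Longrightarrow> j < n \<Longrightarrow> A i j = cnj (A j i)"
    and pos: "\<And>v. Re (qform A n v) \<ge> 0"
  shows "\<exists>\<phi> :: nat \<Rightarrow> nat \<Rightarrow> complex. \<forall>i<n. \<forall>j<n. A i j = (\<Sum>k<n. \<phi> k i * cnj (\<phi> k j))"
  using assms
proof (induction n arbitrary: A)
  case 0
  then show ?case by simp
next
  case (Suc n)
  note herm = Suc.prems(1) and pos = Suc.prems(2)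
  define \<alpha> where "\<alpha> = Re (A n n)"
  have \<alpha>: "A n n = of_real \<alpha>"
    using herm[of n n] by (simp add: \<alpha>_def complex_eq_iff)
  have "\<alpha> \<ge> 0"
    using pos[of "\<lambda>k. if k = n then 1 else 0"] qform_one_point[of n "Suc n" A] \<alpha> by simp
  have zero: "A i n = 0" if "\<alpha> = 0" "i < Suc n" for i
    by (rule psd_kernel_zero_diag[OF herm pos]) (use that \<alpha> in simp_all)
  \<comment> \<open>If \<open>\<alpha> = 0\<close>, the divisions by \<open>\<alpha>\<close> and \<open>sqrt \<alpha>\<close> return 0, which is the correct value
    since then column \<open>n\<close> vanishes.\<close>
  define B where "B i j = A i j - A i n * cnj (A j n) / of_real \<alpha>" for i j
  have "\<exists>\<phi> :: nat \<Rightarrow> nat \<Rightarrow> complex. \<forall>i<n. \<forall>j<n. B i j = (\<Sum>k<n. \<phi> k i * cnj (\<phi> k j))"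
  proof (rule Suc.IH)
    show "B i j = cnj (B j i)" if "i < n" "j < n" for i j
      using herm[of i j] that by (simp add: B_def)
    show "Re (qform B n v) \<ge> 0" for v
    proof -
      \<comment> \<open>For \<alpha> > 0, the last entry of \<open>w\<close> minimizes the form of
        \<open>A\<close> over all extensions of \<open>v\<close> by one coordinate. The minimum is
        the form of \<open>B\<close> at \<open>v\<close>, so positivity passes from \<open>A\<close>
        to \<open>B\<close>.\<close>
      define S where "S = (\<Sum>j<n. A n j * v j)"
      define w where "w = v(n := - S / of_real \<alpha>)"
      have S': "(\<Sum>i<n. cnj (v i) * A i n) = cnj S"
        unfolding S_def cnj_sum using herm[of _ n] by (auto intro!: sum.cong)
      have "qform A n w = qform A n v" "(\<Sum>j<n. A n j * w j) = S"
        "(\<Sum>i<n. cnj (w i) * A i n) = cnj S"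
        unfolding qform_def S_def S'[symmetric, unfolded S_def] w_def by simp_all
      then have "qform A (Suc n) w = qform A n v - S * cnj S / of_real \<alpha>"
        unfolding qform_Suc by (simp add: w_def \<alpha> field_simps power2_eq_square)
      moreover have "qform B n v = qform A n v - S * cnj S / of_real \<alpha>"
      proof -
        have "qform B n v = qform A n v - (\<Sum>i<n. \<Sum>j<n. (cnj (v i) * A i n) * (A n j * v j) / of_real \<alpha>)"
          unfolding qform_def sum_subtractf[symmetric]
          using herm[of n] by (intro sum.cong refl) (auto simp: B_def algebra_simps)
        also have "(\<Sum>i<n. \<Sum>j<n. (cnj (v i) * A i n) * (A n j * v j) / of_real \<alpha>) = cnj S * S / of_real \<alpha>"
          unfolding S'[symmetric] unfolding S_def sum_product sum_divide_distrib ..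
        finally show ?thesis by (simp add: mult.commute)
      qed
      ultimately show ?thesis using pos[of w] by simp
    qed
  qed
  then obtain \<phi> :: "nat \<Rightarrow> nat \<Rightarrow> complex"
    where \<phi>: "\<And>i j. i < n \<Longrightarrow> j < n \<Longrightarrow> B i j = (\<Sum>k<n. \<phi> k i * cnj (\<phi> k j))" by blast
  \<comment> \<open>The new vector is the Cholesky column of the pivot. The old ones are cut off
    outside the first \<open>n\<close> coordinates, where the induction hypothesis says nothing
    about them.\<close>
  define \<psi> where "\<psi> k i = (if k = n then A i n / of_real (sqrt \<alpha>) else if i < n then \<phi> k i else 0)" for k i
  have "A i j = (\<Sum>k<Suc n. \<psi> k i * cnj (\<psi> k j))" if ij: "i < Suc n" "j < Suc n" for i j
  proof -
    have last: "\<psi> n i * cnj (\<psi> n j) = A i n * cnj (A j n) / of_real \<alpha>"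
      using \<open>\<alpha> \<ge> 0\<close> by (simp add: \<psi>_def of_real_mult[symmetric] del: of_real_mult)
    show ?thesis
    proof (cases "i < n \<and> j < n")
      case True
      then have "(\<Sum>k<n. \<psi> k i * cnj (\<psi> k j)) = B i j"
        by (simp add: \<phi> \<psi>_def)
      then show ?thesis using last by (simp add: B_def)
    next
      case False
      then have "(\<Sum>k<n. \<psi> k i * cnj (\<psi> k j)) = 0"
        by (auto simp: \<psi>_def)
      moreover have "A i n * cnj (A j n) / of_real \<alpha> = A i j"
        using False ij zero[of i] zero[of j] herm[of i j] \<alpha>
        by (cases "\<alpha> = 0") (auto simp: less_Suc_eq)
      ultimately show ?thesis using last by simp
    qed
  qed
  then show ?case by blast
qed

section \<open>Completing a unit vector to a unitary matrix\<close>

text \<open>Unitarity is expressed as orthonormality of the rows, because that is the form in which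
  recombining a family by the columns of \<open>h\<close> preserves its Gram sum.\<close>

lemma unitary_with_last_column:
  fixes u :: "nat \<Rightarrow> complex"
  assumes unit: "(\<Sum>i<Suc n. u i * cnj (u i)) = 1"
  obtains h :: "nat \<Rightarrow> nat \<Rightarrow> complex" where "\<And>i. h i n = u i"
    "\<And>i j. i < Suc n \<Longrightarrow> j < Suc n \<Longrightarrow>
      (\<Sum>k<Suc n. h i k * cnj (h j k)) = (if i = j then 1 else 0)"
proof -
  define r where "r = complex_of_real (cmod (u n))"
  \<comment> \<open>The phase of \<open>u n\<close>, set to 1 if \<open>u n = 0\<close>. Adding this
    phase to the last entry gives \<open>s * (1 + r)\<close>, so the denominators
    \<open>1 + r\<close> never vanish.\<close>
  define s where "s = (if u n = 0 then 1 else u n / r)"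
  have s: "s * cnj s = 1" "s * r = u n" "cnj s * r = cnj (u n)" "cnj r = r"
    by (auto simp: s_def r_def norm_divide complex_norm_square[symmetric])
  have r2: "u n * cnj (u n) = r * r"
    unfolding r_def by (metis complex_norm_square of_real_power power2_eq_square)
  have N: "1 + r \<noteq> 0"
    unfolding r_def by (metis Re_complex_of_real norm_ge_zero add_nonneg_eq_0_iff
        of_real_1 of_real_add of_real_eq_0_iff zero_le_one zero_neq_one)
  \<comment> \<open>Householder reflection along \<open>v = u + s e\<^sub>n\<close>, with its last column multiplied by a phase
    to make it \<open>u\<close>\<close>
  define v where "v i = (if i = n then s * (1 + r) else u i)" for i
  define h where "h i k = (if k = n then u i else (if i = k then 1 else 0) - v i * cnj (u k) / (1 + r))"
    for i k
  have tail: "(\<Sum>k<n. u k * cnj (u k)) = (1 - r) * (1 + r)"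
    using unit r2 by (simp add: algebra_simps)
  have "(\<Sum>k<Suc n. h i k * cnj (h j k)) = (if i = j then 1 else 0)"
    if ij: "i < Suc n" "j < Suc n" for i j
  proof -
    have "(\<Sum>k<n. h i k * cnj (h j k)) =
      (\<Sum>k<n. (if k = i then if k = j then 1 else 0 else 0)
        - (if k = i then cnj (v j) * u k / (1 + r) else 0)
        - (if k = j then v i * cnj (u k) / (1 + r) else 0)
        + v i * cnj (v j) / ((1 + r) * (1 + r)) * (u k * cnj (u k)))"
      using N s(4) by (intro sum.cong refl) (auto simp: h_def algebra_simps)
    also have "\<dots> = (if i < n \<and> i = j then 1 else 0) - (if i < n then cnj (v j) * u i / (1 + r) else 0)
        - (if j < n then v i * cnj (u j) / (1 + r) else 0)
        + v i * cnj (v j) / ((1 + r) * (1 + r)) * ((1 - r) * (1 + r))"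
      unfolding sum.distrib sum_subtractf sum_distrib_left[symmetric] tail
      by (simp add: sum.delta)
    also have "v i * cnj (v j) / ((1 + r) * (1 + r)) * ((1 - r) * (1 + r)) = v i * cnj (v j) * (1 - r) / (1 + r)"
      using N by simp
    finally have eq: "(\<Sum>k<Suc n. h i k * cnj (h j k)) =
        (if i < n \<and> i = j then 1 else 0) - (if i < n then cnj (v j) * u i / (1 + r) else 0)
        - (if j < n then v i * cnj (u j) / (1 + r) else 0)
        + v i * cnj (v j) * (1 - r) / (1 + r) + u i * cnj (u j)"
      by (simp add: h_def)
    have vn: "v n = s * (1 + r)" "cnj (v n) = cnj s * (1 + r)" "\<And>i. i < n \<Longrightarrow> v i = u i"
      using s(4) by (simp_all add: v_def)
    have un: "u n = s * r" "cnj (u n) = cnj s * r"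
      using s by simp_all
    consider "i < n" "j < n" | "i = n" "j < n" | "i < n" "j = n" | "i = n" "j = n"
      using ij by linarith
    then show ?thesis
    proof cases
      case 1
      have "x * (1 - r) / (1 + r) = x / (1 + r) + x / (1 + r) - x" for x
      proof -
        have "x * (1 - r) = x + x - x * (1 + r)" by (simp add: algebra_simps)
        then show ?thesis using N by (simp add: add_divide_distrib diff_divide_distrib)
      qed
      from this[of "u i * cnj (u j)"] have "v i * cnj (v j) * (1 - r) / (1 + r) =
          cnj (v j) * u i / (1 + r) + v i * cnj (u j) / (1 + r) - u i * cnj (u j)"
        unfolding vn(3)[OF 1(1)] vn(3)[OF 1(2)] by (simp only: mult.commute)
      with 1 show ?thesis unfolding eq by simp
    next
      case 2
      have "v i * cnj (u j) / (1 + r) = s * cnj (u j)"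
        "v i * cnj (v j) * (1 - r) / (1 + r) = s * cnj (u j) * (1 - r)"
        using 2 N by (simp_all add: vn)
      with 2 show ?thesis unfolding eq by (simp add: un algebra_simps)
    next
      case 3
      have "cnj (v j) * u i / (1 + r) = cnj s * u i"
        "v i * cnj (v j) * (1 - r) / (1 + r) = cnj s * u i * (1 - r)"
        using 3 N by (simp_all add: vn(2,3))
      with 3 show ?thesis unfolding eq by (simp add: un(2) s(4) algebra_simps del: complex_cnj_mult)
    next
      case 4
      have "v n * cnj (v n) * (1 - r) / (1 + r) = (s * cnj s) * ((1 + r) * (1 - r))"
        using N by (simp add: vn s(4))
      with 4 show ?thesis unfolding eq by (simp add: r2 s(1) algebra_simps)
    qed
  qed
  then show ?thesis by (intro that[of h]) (auto simp: h_def)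
qed

section \<open>A matrix pencil with real eigenvalues\<close>

definition adj :: "complex mat \<Rightarrow> complex mat" where
  "adj A = mat (dim_col A) (dim_row A) (\<lambda>(i, j). cnj (A $$ (j, i)))"

definition ip :: "complex vec \<Rightarrow> complex vec \<Rightarrow> complex" where
  "ip v w = (\<Sum>i<dim_vec v. cnj (v $ i) * w $ i)"

lemma adj_carrier: "A \<in> carrier_mat m n \<Longrightarrow> adj A \<in> carrier_mat n m"
  by (simp add: adj_def)

lemma ip_mult_mat_vec:
  assumes A: "A \<in> carrier_mat m n" and v: "v \<in> carrier_vec m" and w: "w \<in> carrier_vec n"
  shows "ip v (A *\<^sub>v w) = ip (adj A *\<^sub>v v) w"
proof -
  have "ip v (A *\<^sub>v w) = (\<Sum>i<m. \<Sum>j<n. cnj (v $ i) * A $$ (i, j) * w $ j)"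
    using A v w by (simp add: ip_def scalar_prod_def sum_distrib_left atLeast0LessThan mult.assoc)
  also have "\<dots> = (\<Sum>j<n. \<Sum>i<m. cnj (v $ i) * A $$ (i, j) * w $ j)"
    by (rule sum.swap)
  also have "\<dots> = ip (adj A *\<^sub>v v) w"
    using A v w
    by (simp add: ip_def adj_def scalar_prod_def sum_distrib_left atLeast0LessThan mult_ac)
  finally show ?thesis .
qed

lemma ip_self: "ip v v = of_real (\<Sum>i<dim_vec v. (cmod (v $ i))\<^sup>2)"
  unfolding ip_def of_real_sum complex_norm_square by (simp add: mult.commute)

lemma ip_self_eq_0_iff: "v \<in> carrier_vec n \<Longrightarrow> ip v v = 0 \<longleftrightarrow> v = 0\<^sub>v n"
  unfolding ip_self of_real_eq_0_iff by (subst sum_nonneg_eq_0_iff) (auto intro!: eq_vecI)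

lemma ip_smult:
  assumes "v \<in> carrier_vec n" "w \<in> carrier_vec n"
  shows "ip v (c \<cdot>\<^sub>v w) = c * ip v w"
  using assms by (simp add: ip_def sum_distrib_left mult_ac)

text \<open>When \<open>X\<close> has trivial kernel, \<open>t * ip u u\<close> is the value at some
  \<open>w\<close> of the form of \<open>Y * adj X\<close>. The hypothesis says that this matrix is
  Hermitian, so the value, and with it \<open>t\<close>, is real.\<close>

lemma hermitian_pencil:
  assumes X: "X \<in> carrier_mat d n" and Y: "Y \<in> carrier_mat d n" and "n > 0"
    and herm: "X * adj Y = Y * adj X"
  obtains u where "u \<in> carrier_vec n" "u \<noteq> 0\<^sub>v n"
    "X *\<^sub>v u = 0\<^sub>v d \<or> (\<exists>t::real. Y *\<^sub>v u = of_real t \<cdot>\<^sub>v (X *\<^sub>v u))"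
proof (cases "\<exists>u \<in> carrier_vec n. u \<noteq> 0\<^sub>v n \<and> X *\<^sub>v u = 0\<^sub>v d")
  case True
  then show ?thesis using that by blast
next
  case False
  note X' = adj_carrier[OF X] and Y' = adj_carrier[OF Y]
  define G where "G = adj X * X"
  have G: "G \<in> carrier_mat n n" using X X' by (simp add: G_def)
  have "det G \<noteq> 0"
  proof
    assume "det G = 0"
    then obtain v where v: "v \<in> carrier_vec n" "v \<noteq> 0\<^sub>v n" "G *\<^sub>v v = 0\<^sub>v n"
      using det_0_iff_vec_prod_zero_field[OF G] by blast
    have Xv: "X *\<^sub>v v \<in> carrier_vec d" using X v by simp
    have "ip (X *\<^sub>v v) (X *\<^sub>v v) = ip (G *\<^sub>v v) v"
      using ip_mult_mat_vec[OF X Xv v(1)] v(1) X X' by (simp add: G_def)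
    then have "X *\<^sub>v v = 0\<^sub>v d"
      using v ip_self_eq_0_iff[OF Xv] by (simp add: ip_def)
    with v False show False by blast
  qed
  from det_non_zero_imp_unit[OF G this, of "()"]
  obtain H where H: "H \<in> carrier_mat n n" "G * H = 1\<^sub>m n"
    unfolding Units_def ring_mat_def by auto
  define Z where "Z = adj Y * (X * H)"
  have XH: "X * H \<in> carrier_mat d n" and Z: "Z \<in> carrier_mat n n"
    using X H Y' by (simp_all add: Z_def)
  have X'XH: "adj X * (X * H) = 1\<^sub>m n"
    using H X X' by (simp add: G_def assoc_mult_mat)
  have "X * Z = (X * adj Y) * (X * H)"
    unfolding Z_def by (rule assoc_mult_mat[symmetric, OF X Y' XH])
  also have "\<dots> = Y * (adj X * (X * H))"
    unfolding herm by (rule assoc_mult_mat[OF Y X' XH])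
  also have "\<dots> = Y" using Y X'XH by simp
  finally have XZ: "X * Z = Y" .
  obtain t where "eigenvalue Z t"
    using spectrum_non_empty[OF Z \<open>n > 0\<close>] by (auto simp: spectrum_def)
  then obtain u where u: "u \<in> carrier_vec n" "u \<noteq> 0\<^sub>v n" "Z *\<^sub>v u = t \<cdot>\<^sub>v u"
    using Z by (auto simp: eigenvalue_def eigenvector_def)
  have Xu: "X *\<^sub>v u \<in> carrier_vec d" and Yu: "Y *\<^sub>v u = t \<cdot>\<^sub>v (X *\<^sub>v u)"
    using u X assoc_mult_mat_vec[OF X Z u(1)] mult_mat_vec[OF X u(1), of t]
    by (simp_all add: XZ)
  \<comment> \<open>Chosen as a preimage of \<open>u\<close> under \<open>adj X\<close>, so that
    \<open>Y *\<^sub>v u\<close> becomes the Hermitian matrix \<open>Y * adj X\<close> applied to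
    \<open>w\<close>.\<close>
  define w where "w = (X * H) *\<^sub>v u"
  have w: "w \<in> carrier_vec d" using XH u by (simp add: w_def)
  have X'w: "adj X *\<^sub>v w = u"
    using assoc_mult_mat_vec[OF X' XH u(1)] X'XH u by (simp add: w_def)
  have Y'w: "adj Y *\<^sub>v w \<in> carrier_vec n" using Y' w by simp
  have wXu: "ip w (X *\<^sub>v u) = ip u u"
    using ip_mult_mat_vec[OF X w u(1)] by (simp add: X'w)
  have cnj_ip: "ip b a = cnj (ip a b)" if "a \<in> carrier_vec k" "b \<in> carrier_vec k" for a b k
    using that by (simp add: ip_def mult.commute)
  have "t * ip u u = ip w (Y *\<^sub>v u)"
    using w Xu by (simp add: Yu ip_smult[of _ d] wXu)
  also have "\<dots> = ip w ((Y * adj X) *\<^sub>v w)"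
    using assoc_mult_mat_vec[OF Y X' w] by (simp add: X'w)
  also have "\<dots> = ip w (X *\<^sub>v (adj Y *\<^sub>v w))"
    unfolding herm[symmetric] using assoc_mult_mat_vec[OF X Y' w] by simp
  also have "\<dots> = ip u (adj Y *\<^sub>v w)"
    using ip_mult_mat_vec[OF X w Y'w] by (simp add: X'w)
  also have "\<dots> = cnj (ip w (Y *\<^sub>v u))"
    using cnj_ip[OF Y'w u(1)] ip_mult_mat_vec[OF Y w u(1)] by simp
  also have "\<dots> = cnj t * cnj (ip u u)"
    using w Xu by (simp add: Yu ip_smult[of _ d] wXu)
  also have "\<dots> = cnj t * ip u u"
    by (simp add: ip_self)
  finally have "t = cnj t"
    using u ip_self_eq_0_iff by simp
  then have "t = of_real (Re t)" by (simp add: complex_eq_iff)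
  with Yu show ?thesis using that u by metis
qed

section \<open>Splitting off vectors with dependent blocks\<close>

text \<open>The first disjunct is the ratio \<open>t = \<infinity>\<close>. The ratio has to be real for
  \<open>real_dependent_block_swap\<close>.\<close>

definition real_dependent :: "nat \<Rightarrow> (nat \<Rightarrow> complex) \<Rightarrow> bool" where
  "real_dependent d v \<longleftrightarrow> (\<forall>j<d. v j = 0) \<or> (\<exists>t::real. \<forall>j<d. v (d + j) = of_real t * v j)"

lemma real_dependent_block_swap:
  assumes "real_dependent d v" "j < d" "l < d"
  shows "v j * cnj (v (d + l)) = v (d + j) * cnj (v l)"
  using assms by (auto simp: real_dependent_def)

text \<open>The hypothesis is \<open>X * adj Y = Y * adj X\<close> read entrywise, so
  \<open>hermitian_pencil\<close> supplies the coefficients. They are normalized in order to serve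
  as a column of a unitary matrix.\<close>

lemma block_swap_combination:
  fixes \<phi> :: "nat \<Rightarrow> nat \<Rightarrow> complex"
  assumes swap: "\<And>j l. j < d \<Longrightarrow> l < d \<Longrightarrow>
      (\<Sum>k<Suc n. \<phi> k j * cnj (\<phi> k (d + l))) = (\<Sum>k<Suc n. \<phi> k (d + j) * cnj (\<phi> k l))"
  obtains u where "(\<Sum>k<Suc n. u k * cnj (u k)) = 1"
    "real_dependent d (\<lambda>r. \<Sum>k<Suc n. \<phi> k r * u k)"
proof -
  define X where "X = mat d (Suc n) (\<lambda>(j, k). \<phi> k j)"
  define Y where "Y = mat d (Suc n) (\<lambda>(j, k). \<phi> k (d + j))"
  have X: "X \<in> carrier_mat d (Suc n)" and Y: "Y \<in> carrier_mat d (Suc n)"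
    by (simp_all add: X_def Y_def)
  have "X * adj Y = Y * adj X"
    using swap by (intro eq_matI)
      (simp_all add: X_def Y_def adj_def scalar_prod_def atLeast0LessThan del: sum.lessThan_Suc)
  from hermitian_pencil[OF X Y zero_less_Suc this]
  obtain u where u: "u \<in> carrier_vec (Suc n)" "u \<noteq> 0\<^sub>v (Suc n)"
    "X *\<^sub>v u = 0\<^sub>v d \<or> (\<exists>t::real. Y *\<^sub>v u = of_real t \<cdot>\<^sub>v (X *\<^sub>v u))" .
  define S where "S = (\<Sum>k<Suc n. (cmod (u $ k))\<^sup>2)"
  have "ip u u = of_real S" unfolding ip_self S_def using u(1) by simp
  then have "S \<noteq> 0" using u(2) ip_self_eq_0_iff[OF u(1)] by simp
  moreover have "S \<ge> 0" unfolding S_def by (intro sum_nonneg) simp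
  ultimately have "S > 0" by simp
  define c where "c = complex_of_real (1 / sqrt S)"
  have c: "c * cnj c = 1 / of_real S"
    unfolding c_def using \<open>S > 0\<close> by (simp add: of_real_mult[symmetric] del: of_real_mult)
  have Xu: "(\<Sum>k<Suc n. \<phi> k j * (c * u $ k)) = c * (X *\<^sub>v u) $ j"
    and Yu: "(\<Sum>k<Suc n. \<phi> k (d + j) * (c * u $ k)) = c * (Y *\<^sub>v u) $ j" if "j < d" for j
    using that u(1) by (simp_all add: X_def Y_def scalar_prod_def atLeast0LessThan
        sum_distrib_left mult_ac del: sum.lessThan_Suc)
  show ?thesis
  proof (rule that[of "\<lambda>k. c * u $ k"])
    have "(\<Sum>k<Suc n. c * u $ k * cnj (c * u $ k)) = (c * cnj c) * (\<Sum>k<Suc n. u $ k * cnj (u $ k))"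
      by (simp add: sum_distrib_left mult_ac del: sum.lessThan_Suc)
    also have "(\<Sum>k<Suc n. u $ k * cnj (u $ k)) = of_real S"
      unfolding S_def of_real_sum complex_norm_square ..
    finally show "(\<Sum>k<Suc n. c * u $ k * cnj (c * u $ k)) = 1"
      using c \<open>S > 0\<close> by simp
    show "real_dependent d (\<lambda>r. \<Sum>k<Suc n. \<phi> k r * (c * u $ k))"
      using u(3)
    proof (elim disjE exE)
      assume "X *\<^sub>v u = 0\<^sub>v d"
      then show ?thesis using Xu by (simp add: real_dependent_def)
    next
      fix t :: real assume t: "Y *\<^sub>v u = of_real t \<cdot>\<^sub>v (X *\<^sub>v u)"
      have "(Y *\<^sub>v u) $ j = of_real t * (X *\<^sub>v u) $ j" if "j < d" for j
        unfolding t using that X by simp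
      then have "\<forall>j<d. (\<Sum>k<Suc n. \<phi> k (d + j) * (c * u $ k))
          = of_real t * (\<Sum>k<Suc n. \<phi> k j * (c * u $ k))"
        using Xu Yu by simp
      then show ?thesis unfolding real_dependent_def by blast
    qed
  qed
qed

text \<open>Induction on the number of vectors. The Gram sums are preserved in all coordinates, not
  only in blocks 0 and 1, since the whole state has to be recovered.\<close>

lemma real_dependent_decomposition:
  fixes \<phi> :: "nat \<Rightarrow> nat \<Rightarrow> complex"
  assumes "\<And>j l. j < d \<Longrightarrow> l < d \<Longrightarrow>
      (\<Sum>k<n. \<phi> k j * cnj (\<phi> k (d + l))) = (\<Sum>k<n. \<phi> k (d + j) * cnj (\<phi> k l))"
  shows "\<exists>\<psi>. (\<forall>r c. (\<Sum>k<n. \<phi> k r * cnj (\<phi> k c)) = (\<Sum>k<n. \<psi> k r * cnj (\<psi> k c)))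
    \<and> (\<forall>k<n. real_dependent d (\<psi> k))"
  using assms
proof (induction n arbitrary: \<phi>)
  case 0
  then show ?case by simp
next
  case (Suc n)
  obtain u where u: "(\<Sum>k<Suc n. u k * cnj (u k)) = 1"
    "real_dependent d (\<lambda>r. \<Sum>k<Suc n. \<phi> k r * u k)"
    by (rule block_swap_combination[where d = d and n = n and \<phi> = \<phi>, OF Suc.prems])
  obtain h where hn: "\<And>i. h i n = u i"
    and unitary: "\<And>i j. i < Suc n \<Longrightarrow> j < Suc n \<Longrightarrow>
      (\<Sum>k<Suc n. h i k * cnj (h j k)) = (if i = j then 1 else 0)"
    using unitary_with_last_column[OF u(1)] by blast
  define \<chi> where "\<chi> k r = (\<Sum>i<Suc n. \<phi> i r * h i k)" for k r
  have \<chi>n: "real_dependent d (\<chi> n)"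
    using u(2) unfolding \<chi>_def hn .
  have gram: "(\<Sum>k<Suc n. \<chi> k r * cnj (\<chi> k c)) = (\<Sum>k<Suc n. \<phi> k r * cnj (\<phi> k c))" for r c
  proof -
    have "(\<Sum>k<Suc n. \<chi> k r * cnj (\<chi> k c)) =
      (\<Sum>k<Suc n. \<Sum>i<Suc n. \<Sum>j<Suc n. \<phi> i r * cnj (\<phi> j c) * (h i k * cnj (h j k)))"
      unfolding \<chi>_def cnj_sum sum_product by (simp add: mult_ac del: sum.lessThan_Suc)
    also have "\<dots> = (\<Sum>i<Suc n. \<Sum>k<Suc n. \<Sum>j<Suc n. \<phi> i r * cnj (\<phi> j c) * (h i k * cnj (h j k)))"
      by (rule sum.swap)
    also have "\<dots> = (\<Sum>i<Suc n. \<Sum>j<Suc n. \<Sum>k<Suc n. \<phi> i r * cnj (\<phi> j c) * (h i k * cnj (h j k)))"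
      by (intro sum.cong refl sum.swap)
    also have "\<dots> = (\<Sum>i<Suc n. \<Sum>j<Suc n. if i = j then \<phi> i r * cnj (\<phi> j c) else 0)"
      unfolding sum_distrib_left[symmetric]
      by (intro sum.cong refl) (simp add: unitary del: sum.lessThan_Suc)
    also have "\<dots> = (\<Sum>i<Suc n. \<phi> i r * cnj (\<phi> i c))"
      by (intro sum.cong refl) (simp add: sum.delta' del: sum.lessThan_Suc)
    finally show ?thesis .
  qed
  \<comment> \<open>The rotated family inherits the swap identity through its Gram sums, and the
    term of \<open>\<chi> n\<close> cancels, which leaves the hypothesis for the first
    \<open>n\<close> vectors.\<close>
  have "(\<Sum>k<n. \<chi> k j * cnj (\<chi> k (d + l))) = (\<Sum>k<n. \<chi> k (d + j) * cnj (\<chi> k l))"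
    if "j < d" "l < d" for j l
  proof -
    have "(\<Sum>k<Suc n. \<chi> k j * cnj (\<chi> k (d + l))) = (\<Sum>k<Suc n. \<chi> k (d + j) * cnj (\<chi> k l))"
      unfolding gram by (rule Suc.prems[OF that])
    then show ?thesis
      using real_dependent_block_swap[OF \<chi>n that] by simp
  qed
  from Suc.IH[where \<phi> = \<chi>, OF this] obtain \<psi>
    where \<psi>: "\<And>r c. (\<Sum>k<n. \<chi> k r * cnj (\<chi> k c)) = (\<Sum>k<n. \<psi> k r * cnj (\<psi> k c))"
      "\<And>k. k < n \<Longrightarrow> real_dependent d (\<psi> k)" by blast
  have "(\<Sum>k<Suc n. \<phi> k r * cnj (\<phi> k c)) =
      (\<Sum>k<Suc n. (\<psi>(n := \<chi> n)) k r * cnj ((\<psi>(n := \<chi> n)) k c))" for r c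
    using gram[of r c] \<psi>(1)[of r c] by simp
  moreover have "\<forall>k<Suc n. real_dependent d ((\<psi>(n := \<chi> n)) k)"
    using \<chi>n \<psi>(2) by (simp add: less_Suc_eq)
  ultimately show ?case by blast
qed

section \<open>Bounding the Schmidt rank\<close>

text \<open>Rank is subadditive and each product term has rank at most 1.\<close>

lemma rank_sum_of_products:
  fixes a b :: "nat \<Rightarrow> nat \<Rightarrow> complex"
  shows "vec_space.rank d (mat d m (\<lambda>(j, l). \<Sum>i<n. a i j * b i l)) \<le> n"
proof (induction n)
  case 0
  have "mat d m (\<lambda>(j, l). \<Sum>i<0. a i j * b i l) = 0\<^sub>m d m" by auto
  then show ?case using vec_space.rank_0I[of d m] by (metis order_refl)
next
  case (Suc n)
  have "mat d m (\<lambda>(j, l). \<Sum>i<Suc n. a i j * b i l)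
    = mat d m (\<lambda>(j, l). \<Sum>i<n. a i j * b i l) + mat d m (\<lambda>(j, l). a n j * b n l)"
    by auto
  moreover have "vec_space.rank d (mat d m (\<lambda>(j, l). a n j * b n l)) \<le> 1"
    by (rule vec_space.rank_le_1_product_entries) auto
  moreover note vec_space.rank_subadditive[where n = d and nc = m
      and A = "mat d m (\<lambda>(j, l). \<Sum>i<n. a i j * b i l)"
      and B = "mat d m (\<lambda>(j, l). a n j * b n l)"]
  ultimately show ?case using Suc.IH by simp
qed

text \<open>The reduced matrix is a sum of \<open>d1\<close> products, one for each block. Those of
  blocks 0 and 1 merge into a single product, which leaves \<open>d1 - 1\<close>.\<close>

lemma schmidt_rank_real_dependent:
  assumes "2 \<le> d1" and \<psi>: "real_dependent d2 v"
  shows "schmidt_rank d1 d2 (vec (d1 * d2) v) \<le> d1 - 1"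
proof -
  obtain m where m: "d1 = Suc (Suc m)"
    using \<open>2 \<le> d1\<close> by (metis Suc_diff_Suc Suc_le_D diff_Suc_1 numeral_2_eq_2 Suc_le_mono)
  have lt: "i * d2 + j < d1 * d2" if "i < d1" "j < d2" for i j
  proof -
    have "i * d2 + j < Suc i * d2" using that by simp
    also have "\<dots> \<le> d1 * d2" using that by (intro mult_right_mono) auto
    finally show ?thesis .
  qed
  have pt: "partial_trace_A d1 d2 (outer (vec (d1 * d2) v)) =
      mat d2 d2 (\<lambda>(j, l). \<Sum>i<d1. v (i * d2 + j) * cnj (v (i * d2 + l)))"
    by (auto simp: partial_trace_A_def outer_def bidx_def lt intro!: eq_matI sum.cong)
  have split: "(\<Sum>i<d1. v (i * d2 + j) * cnj (v (i * d2 + l))) = v j * cnj (v l)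
      + v (d2 + j) * cnj (v (d2 + l))
      + (\<Sum>i<m. v (Suc (Suc i) * d2 + j) * cnj (v (Suc (Suc i) * d2 + l)))" for j l
    unfolding m sum.lessThan_Suc_shift by (simp add: add.assoc)
  obtain c where "\<And>j l. j < d2 \<Longrightarrow> l < d2 \<Longrightarrow>
      v j * cnj (v l) + v (d2 + j) * cnj (v (d2 + l)) = c j * cnj (c l)"
  proof (cases "\<forall>j<d2. v j = 0")
    case True
    then show ?thesis by (intro that[of "\<lambda>j. v (d2 + j)"]) simp
  next
    case False
    then obtain t :: real where t: "\<And>j. j < d2 \<Longrightarrow> v (d2 + j) = of_real t * v j"
      using \<psi> by (auto simp: real_dependent_def)
    \<comment> \<open>With the second block \<open>t\<close> times the first, the two products add
      up to \<open>1 + t\<^sup>2\<close> times the first one; its square root is absorbed into the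
      vector.\<close>
    define s where "s = complex_of_real (sqrt (1 + t\<^sup>2))"
    have s: "s * cnj s = 1 + of_real t * of_real t"
      unfolding s_def by (simp add: of_real_mult[symmetric] power2_eq_square del: of_real_mult)
    show ?thesis
    proof (rule that[of "\<lambda>j. s * v j"])
      fix j l assume "j < d2" "l < d2"
      moreover have "s * v j * cnj (s * v l) = (s * cnj s) * (v j * cnj (v l))" by simp
      ultimately show "v j * cnj (v l) + v (d2 + j) * cnj (v (d2 + l)) = s * v j * cnj (s * v l)"
        unfolding s by (simp add: t distrib_right)
    qed
  qed
  note c = this
  define a where "a i j = (case i of 0 \<Rightarrow> c j | Suc i' \<Rightarrow> v (Suc (Suc i') * d2 + j))" for i j
  have "(\<Sum>i<d1. v (i * d2 + j) * cnj (v (i * d2 + l))) = (\<Sum>i<Suc m. a i j * cnj (a i l))"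
    if "j < d2" "l < d2" for j l
    unfolding split c[OF that] sum.lessThan_Suc_shift a_def by simp
  then have "partial_trace_A d1 d2 (outer (vec (d1 * d2) v)) =
      mat d2 d2 (\<lambda>(j, l). \<Sum>i<Suc m. a i j * cnj (a i l))"
    unfolding pt by (intro eq_matI) (simp_all del: sum.lessThan_Suc)
  then show ?thesis
    unfolding schmidt_rank_def
    using rank_sum_of_products[of d2 d2 a "\<lambda>i l. cnj (a i l)" "Suc m"] by (simp only: m diff_Suc_1)
qed

section \<open>From Gram sums to the Schmidt number\<close>

lemma real_dependent_scale:
  assumes "real_dependent d v"
  shows "real_dependent d (\<lambda>r. c * v r)"
  using assms by (auto simp: real_dependent_def mult.left_commute)

lemma psd_hermitian_decomposition:
  assumes "psd \<rho>" and \<rho>: "\<rho> \<in> carrier_mat n n"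
  obtains \<phi> :: "nat \<Rightarrow> nat \<Rightarrow> complex"
    where "\<And>r c. r < n \<Longrightarrow> c < n \<Longrightarrow> \<rho> $$ (r, c) = (\<Sum>k<n. \<phi> k r * cnj (\<phi> k c))"
proof -
  define A where "A r c = \<rho> $$ (r, c)" for r c
  obtain N where N: "\<rho> \<in> carrier_mat N N" and pos: "\<forall>v \<in> carrier_vec N.
      Im (\<Sum>i<N. cnj (v $ i) * (\<rho> *\<^sub>v v) $ i) = 0 \<and> Re (\<Sum>i<N. cnj (v $ i) * (\<rho> *\<^sub>v v) $ i) \<ge> 0"
    using \<open>psd \<rho>\<close> unfolding psd_def Let_def by blast
  \<comment> \<open>\<open>psd\<close> hides the dimension behind an existential; the carrier of
    \<rho> determines it.\<close>
  have "N = n" using N \<rho> by auto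
  have q: "Im (qform A n v) = 0" "Re (qform A n v) \<ge> 0" for v
  proof -
    have "qform A n v = (\<Sum>i<n. cnj (vec n v $ i) * (\<rho> *\<^sub>v vec n v) $ i)"
      using \<rho> by (simp add: qform_def A_def scalar_prod_def sum_distrib_left atLeast0LessThan mult.assoc)
    moreover have "vec n v \<in> carrier_vec n" by simp
    ultimately show "Im (qform A n v) = 0" "Re (qform A n v) \<ge> 0"
      using pos unfolding \<open>N = n\<close> by (metis (no_types))+
  qed
  have "\<exists>\<phi> :: nat \<Rightarrow> nat \<Rightarrow> complex. \<forall>i<n. \<forall>j<n. A i j = (\<Sum>k<n. \<phi> k i * cnj (\<phi> k j))"
    by (intro psd_kernel_decomposition q(2)) (rule real_qform_hermitian[OF q(1)])
  then show ?thesis using that unfolding A_def by blast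
qed

lemma schmidt_number_le:
  assumes dec: "pure_decomposition d1 d2 \<rho> m p \<psi>"
    and rank: "\<And>k. k < m \<Longrightarrow> schmidt_rank d1 d2 (\<psi> k) \<le> b"
  shows "schmidt_number d1 d2 \<rho> \<le> b"
proof -
  \<comment> \<open>An empty family cannot have weights summing to 1, so \<open>Max\<close> ranges
    over a nonempty set.\<close>
  have "m \<noteq> 0" using dec by (auto simp: pure_decomposition_def intro: ccontr)
  have "schmidt_number d1 d2 \<rho> \<le> Max (schmidt_rank d1 d2 ` \<psi> ` {..<m})"
    unfolding schmidt_number_def using dec by (intro cInf_lower) auto
  also have "\<dots> \<le> b"
    using rank \<open>m \<noteq> 0\<close> by (subst Max_le_iff) auto
  finally show ?thesis .
qed

text \<open>The weights are the squared norms, which sum to the trace. A zero vector cannot be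
  normalized, so the basis vector number 0 replaces it, with weight 0.\<close>

lemma pure_decomposition_normalize:
  assumes \<rho>: "\<rho> \<in> carrier_mat (d1 * d2) (d1 * d2)" and "mtrace \<rho> = 1"
    and dec: "\<And>r c. r < d1 * d2 \<Longrightarrow> c < d1 * d2 \<Longrightarrow>
      \<rho> $$ (r, c) = (\<Sum>k<m. \<phi> k r * cnj (\<phi> k c))"
  defines "w \<equiv> \<lambda>k. \<Sum>r<d1 * d2. (cmod (\<phi> k r))\<^sup>2"
  shows "pure_decomposition d1 d2 \<rho> m w (\<lambda>k. vec (d1 * d2)
    (if w k = 0 then (\<lambda>r. if r = 0 then 1 else 0)
     else (\<lambda>r. complex_of_real (1 / sqrt (w k)) * \<phi> k r)))"
    (is "pure_decomposition _ _ _ _ _ (\<lambda>k. vec ?D (?\<psi> k))")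
proof -
  have "?D \<noteq> 0"
  proof
    assume "?D = 0"
    then have "dim_row \<rho> = 0" using \<rho> by (simp only: carrier_matD)
    then show False using \<open>mtrace \<rho> = 1\<close> by (simp add: mtrace_def)
  qed
  have w0: "w k \<ge> 0" for k unfolding w_def by (intro sum_nonneg) simp
  have unit: "unit_vec_c ?D (vec ?D (?\<psi> k))" for k
  proof (cases "w k = 0")
    case True
    have "(\<Sum>i<?D. (cmod (if i = 0 then 1 else 0))\<^sup>2) = (\<Sum>i<?D. if i = 0 then 1 else 0::real)"
      by (intro sum.cong) auto
    also have "\<dots> = 1" using \<open>?D \<noteq> 0\<close> by (simp add: sum.delta del: mult_eq_0_iff)
    finally show ?thesis using True by (simp add: unit_vec_c_def cong: if_cong)
  next
    case False
    have "(\<Sum>i<?D. (cmod (complex_of_real (1 / sqrt (w k)) * \<phi> k i))\<^sup>2)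
        = (\<Sum>i<?D. (cmod (\<phi> k i))\<^sup>2 / w k)"
      using w0[of k] by (intro sum.cong refl) (simp add: norm_mult norm_divide power_divide)
    also have "\<dots> = 1" using False by (simp add: sum_divide_distrib[symmetric]) (simp add: w_def)
    finally show ?thesis using False by (simp add: unit_vec_c_def)
  qed
  have summand: "of_real (w k) * (?\<psi> k r * cnj (?\<psi> k c)) = \<phi> k r * cnj (\<phi> k c)"
    if "r < ?D" "c < ?D" for k r c
  proof (cases "w k = 0")
    case True
    then have "\<phi> k r = 0"
      using that(1) unfolding w_def by (subst (asm) sum_nonneg_eq_0_iff) auto
    with True show ?thesis by simp
  next
    case False
    have "complex_of_real (1 / sqrt (w k)) * cnj (complex_of_real (1 / sqrt (w k))) = of_real (1 / w k)"
      using w0[of k] by (simp add: of_real_mult[symmetric] del: of_real_mult)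
    then have "of_real (w k) * (complex_of_real (1 / sqrt (w k)) * cnj (complex_of_real (1 / sqrt (w k)))) = 1"
      using False by simp
    moreover have "of_real (w k) * (?\<psi> k r * cnj (?\<psi> k c)) =
      (of_real (w k) * (complex_of_real (1 / sqrt (w k)) * cnj (complex_of_real (1 / sqrt (w k)))))
        * (\<phi> k r * cnj (\<phi> k c))"
      using False by (simp only: if_False complex_cnj_mult mult_ac)
    ultimately show ?thesis by simp
  qed
  have "(\<Sum>r<?D. \<Sum>k<m. \<phi> k r * cnj (\<phi> k r)) = 1"
    using \<open>mtrace \<rho> = 1\<close> \<rho> dec by (simp add: mtrace_def)
  then have "(\<Sum>k<m. \<Sum>r<?D. \<phi> k r * cnj (\<phi> k r)) = 1"
    by (subst sum.swap)
  then have "complex_of_real (\<Sum>k<m. w k) = 1"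
    unfolding w_def of_real_sum complex_norm_square .
  then have "(\<Sum>k<m. w k) = 1" by (simp only: of_real_eq_1_iff)
  moreover have "\<rho> = mat ?D ?D (\<lambda>(r, c). \<Sum>k<m. complex_of_real (w k) * (outer (vec ?D (?\<psi> k)) $$ (r, c)))"
    using \<rho> dec summand by (intro eq_matI) (auto simp: outer_def intro!: sum.cong)
  ultimately show ?thesis
    unfolding pure_decomposition_def using w0 unit by blast
qed

theorem theorem20:
  fixes d1 d2 :: nat and \<rho> :: "complex mat"
  assumes "2 \<le> d1" and "d1 \<le> d2"
    and "quantum_state (d1 * d2) \<rho>"
    and "partial_transpose_A d1 d2 \<rho> = \<rho>"
  shows "schmidt_number d1 d2 \<rho> \<le> d1 - 1"
proof -
  have \<rho>: "\<rho> \<in> carrier_mat (d1 * d2) (d1 * d2)" "psd \<rho>" "mtrace \<rho> = 1"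
    using assms(3) by (auto simp: quantum_state_def)
  obtain \<phi> where \<phi>: "\<And>r c. r < d1 * d2 \<Longrightarrow> c < d1 * d2 \<Longrightarrow>
      \<rho> $$ (r, c) = (\<Sum>k<d1 * d2. \<phi> k r * cnj (\<phi> k c))"
    using psd_hermitian_decomposition[OF \<rho>(2,1)] by blast
  have "2 * d2 \<le> d1 * d2" using assms(1) by (intro mult_right_mono) auto
  then have bounds: "j < d1 * d2" "d2 + j < d1 * d2" if "j < d2" for j
    using that by linarith+
  \<comment> \<open>Partial transposition exchanges the off-diagonal blocks (0,1) and (1,0); both
    exist because \<open>2 \<le> d1\<close>.\<close>
  have "\<rho> $$ (j, d2 + l) = \<rho> $$ (d2 + j, l)" if "j < d2" "l < d2" for j l
  proof -
    have "\<rho> $$ (j, d2 + l) = partial_transpose_A d1 d2 \<rho> $$ (j, d2 + l)"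
      by (simp only: assms(4))
    also have "\<dots> = \<rho> $$ (d2 + j, l)"
      using bounds that by (simp add: partial_transpose_A_def bidx_def)
    finally show ?thesis .
  qed
  then have swap: "(\<Sum>k<d1 * d2. \<phi> k j * cnj (\<phi> k (d2 + l))) = (\<Sum>k<d1 * d2. \<phi> k (d2 + j) * cnj (\<phi> k l))"
    if "j < d2" "l < d2" for j l
    using that by (simp add: \<phi>[symmetric] bounds)
  obtain \<psi> where \<psi>: "\<And>r c. (\<Sum>k<d1 * d2. \<phi> k r * cnj (\<phi> k c)) = (\<Sum>k<d1 * d2. \<psi> k r * cnj (\<psi> k c))"
      "\<And>k. k < d1 * d2 \<Longrightarrow> real_dependent d2 (\<psi> k)"
    using real_dependent_decomposition[where \<phi> = \<phi>, OF swap] by blast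
  show ?thesis
  proof (rule schmidt_number_le[OF pure_decomposition_normalize[OF \<rho>(1,3)]])
    show "\<rho> $$ (r, c) = (\<Sum>k<d1 * d2. \<psi> k r * cnj (\<psi> k c))" if "r < d1 * d2" "c < d1 * d2" for r c
      using \<phi>[OF that] \<psi>(1) by simp
    \<comment> \<open>The replacement for zero vectors qualifies with ratio 0: as
      \<open>d2 > 0\<close>, its only nonzero entry lies in block 0.\<close>
    have "real_dependent d2 (\<lambda>r. if r = 0 then 1 else 0)"
      using assms(1,2) by (auto simp: real_dependent_def intro: exI[of _ 0])
    then show "schmidt_rank d1 d2 (vec (d1 * d2)
        (if (\<Sum>r<d1 * d2. (cmod (\<psi> k r))\<^sup>2) = 0 then (\<lambda>r. if r = 0 then 1 else 0)
         else (\<lambda>r. complex_of_real (1 / sqrt (\<Sum>r<d1 * d2. (cmod (\<psi> k r))\<^sup>2)) * \<psi> k r))) \<le> d1 - 1"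
      if "k < d1 * d2" for k
      using real_dependent_scale[OF \<psi>(2)[OF that]]
      by (intro schmidt_rank_real_dependent assms(1)) (simp only: if_True if_False split: if_split, blast)
  qed
qed

end
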